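(* Let $K$ be a field, $S=K[x_1,\ldots,x_n]$, $T=K[x_1,\ldots,x_{n-1}]$, and let $\varphi\colon S\to T$ be the $K$-algebra homomorphism with $x_i\mapsto x_i$ for $i=1,\ldots,n-1$ and $x_n\mapsto 1$. Let $I\subset S$ be a monomial ideal. Then $$\operatorname{sdepth} T/\varphi(I)\ \ge\ \operatorname{sdepth} S/I-1.$$
   Context: The following definitions are given for $S$ and apply equally to $T$. For a monomial ideal $I\subset S$ let $I^c\subset S$ be the $K$-linear span of all monomials not in $I$, so $S/I\cong I^c$ as $K$-vector spaces. For a monomial $u\in S$ and $Z\subset\{x_1,\ldots,x_n\}$, the $K$-subspace $uK[Z]$ with basis all monomials $uv$, $v$ a monomial of $K[Z]$, is called a Stanley space of dimension $|Z|$. A Stanley decomposition $\mathcal D$ of $S/I$ is a decomposition of $I^c$ as a finite direct sum of Stanley spaces; $\operatorname{sdepth}\mathcal D$ is the minimal dimension of a Stanley space in $\mathcal D$, and $\operatorname{sdepth} S/I$ is the maximum of $\operatorname{sdepth}\mathcal D$ over all Stanley decompositions $\mathcal D$ of $S/I$. *)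

theory Defs
  imports "HOL-Library.Poly_Mapping" "HOL-Library.Extended_Nat" "HOL-Algebra.QuotRing"
begin

text \<open>
  Polynomials over \<open>'k\<close> in variables \<open>x\<^sub>i\<close> (\<open>i :: nat\<close>) are finitely supported maps from
  exponent vectors to coefficients. The ring \<open>K[x\<^sub>1, \<dots>, x\<^sub>n]\<close> consists of those
  involving only the variables with index in \<open>{1..n}\<close>, so that \<open>K[x\<^sub>1, \<dots>, x\<^sub>m]\<close> is literally
  a subring of \<open>K[x\<^sub>1, \<dots>, x\<^sub>n]\<close> for \<open>m \<le> n\<close>.
\<close>

type_synonym expo = "nat \<Rightarrow>\<^sub>0 nat"
type_synonym 'k mpol = "expo \<Rightarrow>\<^sub>0 'k"

definition expos :: "nat set \<Rightarrow> expo set" where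
  "expos Z = {u. Poly_Mapping.keys u \<subseteq> Z}"

definition mon :: "expo \<Rightarrow> 'k::field mpol" where
  "mon u = Poly_Mapping.single u 1"

definition Var :: "nat \<Rightarrow> 'k::field mpol" where
  "Var i = mon (Poly_Mapping.single i 1)"

definition Const :: "'k::field \<Rightarrow> 'k mpol" where
  "Const c = Poly_Mapping.single 0 c"

definition polring :: "nat \<Rightarrow> 'k::field mpol ring" where
  "polring n = \<lparr>carrier = {p. Poly_Mapping.keys p \<subseteq> expos {1..n}},
                mult = (*), one = 1, zero = 0, add = (+)\<rparr>"

definition monomials :: "nat \<Rightarrow> 'k::field mpol set" where
  "monomials n = mon ` expos {1..n}"

definition monomial_ideal :: "nat \<Rightarrow> 'k::field mpol set \<Rightarrow> bool" where
  "monomial_ideal n I \<longleftrightarrow> (\<exists>G. G \<subseteq> monomials n \<and> I = genideal (polring n) G)"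

definition scale :: "'k::field \<Rightarrow> 'k mpol \<Rightarrow> 'k mpol" where
  "scale c p = Const c * p"

interpretation mpol: vector_space "scale :: 'k::field \<Rightarrow> 'k mpol \<Rightarrow> 'k mpol"
proof
  fix a b :: 'k and x y :: "'k mpol"
  show "scale a (x + y) = scale a x + scale a y"
    by (simp add: scale_def algebra_simps)
  show "scale (a + b) x = scale a x + scale b x"
    by (simp add: scale_def Const_def single_add algebra_simps)
  show "scale a (scale b x) = scale (a * b) x"
    by (simp add: scale_def Const_def mult_single mult.assoc[symmetric])
  show "scale 1 x = x"
    by (simp add: scale_def Const_def)
qed

definition compl_space :: "nat \<Rightarrow> 'k::field mpol set \<Rightarrow> 'k mpol set" where
  "compl_space n I = mpol.span (monomials n - I)"

definition stanley_space :: "expo \<Rightarrow> nat set \<Rightarrow> 'k::field mpol set" where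
  "stanley_space u Z = mpol.span {mon u * mon v | v. v \<in> expos Z}"

text \<open>\<open>W\<close> is the internal direct sum of \<open>V i\<close>, \<open>i \<in> A\<close>: every family of summands has its sum in
  \<open>W\<close>, and every element of \<open>W\<close> is such a sum in exactly one way.\<close>

definition direct_sum :: "'v::comm_monoid_add set \<Rightarrow> 'i set \<Rightarrow> ('i \<Rightarrow> 'v set) \<Rightarrow> bool" where
  "direct_sum W A V \<longleftrightarrow> bij_betw (\<lambda>f. \<Sum>i\<in>A. f i) (Pi\<^sub>E A V) W"

text \<open>A Stanley decomposition of \<open>K[x\<^sub>1, \<dots>, x\<^sub>n]/I\<close> is given by the finite set of pairs \<open>(u, Z)\<close>
  of its Stanley spaces \<open>uK[Z]\<close>. A set suffices: a nonzero space cannot occur twice in a direct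
  sum, and \<open>uK[Z]\<close> determines \<open>u\<close> and \<open>Z\<close>.\<close>

definition stanley_decomp ::
    "nat \<Rightarrow> 'k::field mpol set \<Rightarrow> (expo \<times> nat set) set \<Rightarrow> bool" where
  "stanley_decomp n I D \<longleftrightarrow>
     finite D \<and> D \<subseteq> expos {1..n} \<times> Pow {1..n} \<and>
     direct_sum (compl_space n I) D (\<lambda>(u, Z). stanley_space u Z)"

text \<open>Values are in \<open>enat\<close>. The zero space has only the empty decomposition, whose minimum is
  \<open>\<infinity>\<close>, so \<open>sdepth n I = \<infinity>\<close> when \<open>I\<close> is the unit ideal. For every other monomial ideal the
  supremum in \<open>sdepth\<close> is over a nonempty set of numbers at most \<open>n\<close>, hence a maximum.\<close>

definition sdepth_decomp :: "(expo \<times> nat set) set \<Rightarrow> enat" where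
  "sdepth_decomp D = (INF (u, Z)\<in>D. enat (card Z))"

definition sdepth :: "nat \<Rightarrow> 'k::field mpol set \<Rightarrow> enat" where
  "sdepth n I = (SUP D\<in>{D. stanley_decomp n I D}. sdepth_decomp D)"

text \<open>Homomorphisms of \<open>K\<close>-algebras \<open>K[x\<^sub>1, \<dots>, x\<^sub>n] \<rightarrow> K[x\<^sub>1, \<dots>, x\<^sub>m]\<close>. Values outside the
  carrier of the source are irrelevant.\<close>

definition alg_hom :: "nat \<Rightarrow> nat \<Rightarrow> ('k::field mpol \<Rightarrow> 'k mpol) \<Rightarrow> bool" where
  "alg_hom n m \<phi> \<longleftrightarrow>
     \<phi> \<in> ring_hom (polring n) (polring m) \<and> (\<forall>c. \<phi> (Const c) = Const c)"

end

theory Submission imports Defs begin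

text \<open>
  A monomial \<open>w \<in> T\<close> lies outside \<open>\<phi>(I)\<close> iff \<open>w x\<^sub>n\<^sup>k \<notin> I\<close> for all \<open>k\<close>. Given a Stanley
  decomposition of \<open>S/I\<close>, choose \<open>N\<close> larger than the \<open>x\<^sub>n\<close>-degree of every \<open>u\<close> occurring in it. The
  Stanley space \<open>uK[Z]\<close> containing \<open>w x\<^sub>n\<^sup>N\<close> then satisfies \<open>x\<^sub>n \<in> Z\<close>, and conversely
  \<open>uK[Z]\<close> with \<open>x\<^sub>n \<in> Z\<close> contains \<open>w x\<^sub>n\<^sup>N\<close> iff \<open>w \<in> \<phi>(u)K[Z - {x\<^sub>n}]\<close>. So the spaces
  \<open>\<phi>(u)K[Z - {x\<^sub>n}]\<close> with \<open>x\<^sub>n \<in> Z\<close> form a Stanley decomposition of \<open>T/\<phi>(I)\<close>.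
\<close>

abbreviation lookup :: "('a \<Rightarrow>\<^sub>0 'b::zero) \<Rightarrow> 'a \<Rightarrow> 'b" where
  "lookup \<equiv> Poly_Mapping.lookup"

abbreviation keys :: "('a \<Rightarrow>\<^sub>0 'b::zero) \<Rightarrow> 'a set" where
  "keys \<equiv> Poly_Mapping.keys"

abbreviation single :: "'a \<Rightarrow> 'b \<Rightarrow> ('a \<Rightarrow>\<^sub>0 'b::zero)" where
  "single \<equiv> Poly_Mapping.single"

section \<open>Direct sums of subspaces given by supports\<close>

definition supported_in :: "'a set \<Rightarrow> ('a \<Rightarrow>\<^sub>0 'b::zero) set" where
  "supported_in A = {p. keys p \<subseteq> A}"

text \<open>This is the coordinate projection onto \<open>supported_in A\<close>. It supplies the
  components of an element in a direct sum of such subspaces.\<close>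

definition restrict_keys :: "'a set \<Rightarrow> ('a \<Rightarrow>\<^sub>0 'b) \<Rightarrow> ('a \<Rightarrow>\<^sub>0 'b::comm_monoid_add)" where
  "restrict_keys A p = (\<Sum>v\<in>keys p \<inter> A. single v (lookup p v))"

lemma lookup_restrict_keys: "lookup (restrict_keys A p) v = (if v \<in> A then lookup p v else 0)"
proof -
  have "lookup (restrict_keys A p) v = (\<Sum>w\<in>keys p \<inter> A. if w = v then lookup p v else 0)"
    unfolding restrict_keys_def lookup_sum
    by (intro sum.cong) (auto simp: lookup_single when_def)
  also have "\<dots> = (if v \<in> A then lookup p v else 0)"
    by (simp add: in_keys_iff)
  finally show ?thesis .
qed

lemma sum_single_lookup: "(\<Sum>v\<in>keys p. single v (lookup p v)) = p"
  for p :: "'a \<Rightarrow>\<^sub>0 'b::comm_monoid_add"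
proof -
  have "(\<Sum>v\<in>keys p. single v (lookup p v)) = restrict_keys UNIV p"
    by (simp add: restrict_keys_def)
  also have "\<dots> = p"
    by (rule poly_mapping_eqI) (simp add: lookup_restrict_keys)
  finally show ?thesis .
qed

lemma lookup_eq_0_outside: "p \<in> supported_in A \<Longrightarrow> v \<notin> A \<Longrightarrow> lookup p v = 0"
  by (auto simp: supported_in_def in_keys_iff)

text \<open>Forward, uniqueness and existence of components are tested on the basis vectors
  \<open>single v 1\<close>. Backward, each exponent of \<open>B\<close> lies in exactly one
  \<open>C i\<close>, so the components can be read off coordinate by coordinate.\<close>

lemma direct_sum_supported_in_iff:
  fixes C :: "'i \<Rightarrow> 'a set"
  assumes "finite D"
  shows "direct_sum (supported_in B :: ('a \<Rightarrow>\<^sub>0 'b::comm_semiring_1) set) D (\<lambda>i. supported_in (C i))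
    \<longleftrightarrow> (\<Union>i\<in>D. C i) = B \<and> (\<forall>i\<in>D. \<forall>j\<in>D. i \<noteq> j \<longrightarrow> C i \<inter> C j = {})"
    (is "direct_sum ?W D ?V \<longleftrightarrow> ?R")
proof
  assume ds: "direct_sum ?W D ?V"
  \<comment> \<open>The family with a basis vector in slot \<open>i\<close> and zero in every other
    slot of \<open>D\<close>. If \<open>v\<close> lay in both \<open>C i\<close> and
    \<open>C j\<close>, the families for \<open>i\<close> and \<open>j\<close> would have the same
    sum, against injectivity.\<close>
  define e :: "'a \<Rightarrow> 'i \<Rightarrow> 'i \<Rightarrow> 'a \<Rightarrow>\<^sub>0 'b" where
    "e v i = (\<lambda>j\<in>D. if j = i then single v 1 else 0)" for v i
  have e_in: "e v i \<in> Pi\<^sub>E D ?V" if "i \<in> D" "v \<in> C i" for v i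
    using that by (auto simp: e_def supported_in_def)
  have e_sum: "(\<Sum>j\<in>D. e v i j) = single v 1" if "i \<in> D" for v i
    using that assms by (simp add: e_def)
  have inj: "inj_on (\<lambda>f. \<Sum>i\<in>D. f i) (Pi\<^sub>E D ?V)"
    and img: "(\<lambda>f. \<Sum>i\<in>D. f i) ` Pi\<^sub>E D ?V = ?W"
    using ds unfolding direct_sum_def bij_betw_def by blast+
  have disj: "C i \<inter> C j = {}" if "i \<in> D" "j \<in> D" "i \<noteq> j" for i j
  proof (rule ccontr)
    assume "C i \<inter> C j \<noteq> {}"
    then obtain v where v: "v \<in> C i" "v \<in> C j" by blast
    have "e v i = e v j"
      using inj by (rule inj_onD) (use that v in \<open>simp_all add: e_in e_sum\<close>)
    then have "lookup (e v i i) v = lookup (e v j i) v" by simp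
    then show False using that by (simp add: e_def)
  qed
  have le: "v \<in> B" if "i \<in> D" "v \<in> C i" for i v
  proof -
    have "(\<Sum>j\<in>D. e v i j) \<in> ?W"
      unfolding img[symmetric] using e_in[OF that] by (rule imageI)
    then have "single v 1 \<in> ?W" unfolding e_sum[OF that(1)] .
    then show ?thesis by (simp add: supported_in_def)
  qed
  have ge: "\<exists>i\<in>D. v \<in> C i" if "v \<in> B" for v
  proof -
    have "single v 1 \<in> ?W" using that by (simp add: supported_in_def)
    then obtain f where f: "single v 1 = (\<Sum>i\<in>D. f i)" "f \<in> Pi\<^sub>E D ?V"
      unfolding img[symmetric] by (rule imageE)
    have "v \<in> keys (\<Sum>i\<in>D. f i)" unfolding f(1)[symmetric] by simp
    then have "v \<in> (\<Union>i\<in>D. keys (f i))" by (rule subsetD[OF keys_sum])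
    then obtain i where i: "i \<in> D" "v \<in> keys (f i)" ..
    have "f i \<in> ?V i" using f(2) i(1) by (rule PiE_mem)
    then show ?thesis using i by (auto simp: supported_in_def)
  qed
  have "(\<Union>i\<in>D. C i) = B"
  proof (rule Set.set_eqI)
    fix v
    show "v \<in> (\<Union>i\<in>D. C i) \<longleftrightarrow> v \<in> B" using le[of _ v] ge[of v] by auto
  qed
  then show ?R using disj by simp
next
  assume R: ?R
  \<comment> \<open>At an exponent of \<open>C i\<close> all other summands vanish by disjointness,
    so the sum determines \<open>f i\<close> there.\<close>
  have lookup_f: "lookup (\<Sum>j\<in>D. f j) v = lookup (f i) v"
    if "f \<in> Pi\<^sub>E D ?V" "i \<in> D" "v \<in> C i" for f i v
  proof -
    have "lookup (\<Sum>j\<in>D. f j) v = (\<Sum>j\<in>D. if j = i then lookup (f i) v else 0)"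
      unfolding lookup_sum
    proof (intro sum.cong refl)
      fix j assume "j \<in> D"
      moreover have "v \<notin> C j" if "j \<noteq> i" using R that \<open>i \<in> D\<close> \<open>v \<in> C i\<close> \<open>j \<in> D\<close> by blast
      ultimately show "lookup (f j) v = (if j = i then lookup (f i) v else 0)"
        using that(1) by (auto intro: lookup_eq_0_outside)
    qed
    then show ?thesis using assms that by simp
  qed
  have "inj_on (\<lambda>f. \<Sum>i\<in>D. f i) (Pi\<^sub>E D ?V)"
  proof (rule inj_onI)
    fix f g assume fg: "f \<in> Pi\<^sub>E D ?V" "g \<in> Pi\<^sub>E D ?V" "(\<Sum>i\<in>D. f i) = (\<Sum>i\<in>D. g i)"
    show "f = g"
    proof (rule PiE_ext[OF fg(1,2)])
      fix i assume i: "i \<in> D"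
      show "f i = g i"
      proof (rule poly_mapping_eqI)
        fix v
        show "lookup (f i) v = lookup (g i) v"
        proof (cases "v \<in> C i")
          case True
          then show ?thesis using lookup_f[OF fg(1) i] lookup_f[OF fg(2) i] fg(3) by simp
        next
          case False
          then have "lookup (f i) v = 0" "lookup (g i) v = 0"
            using fg(1,2) i by (auto intro: lookup_eq_0_outside)
          then show ?thesis by simp
        qed
      qed
    qed
  qed
  moreover have "(\<Sum>i\<in>D. f i) \<in> ?W" if "f \<in> Pi\<^sub>E D ?V" for f
  proof -
    have "keys (f i) \<subseteq> B" if "i \<in> D" for i
      using \<open>f \<in> _\<close> R that by (fastforce simp: supported_in_def PiE_iff)
    then show ?thesis using keys_sum[of f D] by (fastforce simp: supported_in_def)
  qed
  moreover have "p \<in> (\<lambda>f. \<Sum>i\<in>D. f i) ` Pi\<^sub>E D ?V" if p: "p \<in> ?W" for p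
  proof
    \<comment> \<open>The components of \<open>p\<close> are its projections. They add up to
      \<open>p\<close> on \<open>B\<close> because the \<open>C i\<close> partition
      \<open>B\<close>; outside \<open>B\<close> both sides are zero.\<close>
    define f where "f = (\<lambda>i\<in>D. restrict_keys (C i) p)"
    show f: "f \<in> Pi\<^sub>E D ?V"
      by (auto simp: f_def supported_in_def in_keys_iff lookup_restrict_keys split: if_splits)
    show "p = (\<Sum>i\<in>D. f i)"
    proof (rule poly_mapping_eqI)
      fix v
      show "lookup p v = lookup (\<Sum>i\<in>D. f i) v"
      proof (cases "v \<in> B")
        case True
        then obtain i where "i \<in> D" "v \<in> C i" using R by blast
        then show ?thesis using lookup_f[OF f] by (simp add: f_def lookup_restrict_keys)
      next
        case False
        then have "v \<notin> C i" if "i \<in> D" for i using R that by blast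
        then show ?thesis using False p
          by (simp add: lookup_eq_0_outside lookup_sum f_def lookup_restrict_keys)
      qed
    qed
  qed
  ultimately show "direct_sum ?W D ?V" unfolding direct_sum_def bij_betw_def by blast
qed

section \<open>Stanley decompositions as partitions of exponent sets\<close>

lemma mon_mult: "mon u * mon v = mon (u + v)"
  by (simp add: mon_def mult_single)

lemma mon_0: "mon 0 = 1"
  by (simp add: mon_def)

lemma scale_mon: "scale c (mon v) = single v c"
  by (simp add: scale_def Const_def mon_def mult_single)

text \<open>The right-hand side is a subspace containing these monomials, and each of its members is
  the linear combination of its own terms. Spans thereby become conditions on supports.\<close>

lemma span_mon: "mpol.span (mon ` A) = (supported_in A :: 'k::field mpol set)"
proof
  have "mpol.subspace (supported_in A :: 'k mpol set)"
  proof (rule mpol.subspaceI)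
    fix c :: 'k and p q :: "'k mpol"
    assume p: "p \<in> supported_in A"
    show "p + q \<in> supported_in A" if "q \<in> supported_in A"
      using p that keys_add[of p q] by (auto simp: supported_in_def)
    have "keys (scale c p) \<subseteq> keys p"
      unfolding scale_def Const_def using keys_mult[of "single 0 c" p]
      by (auto split: if_splits)
    then show "scale c p \<in> supported_in A" using p by (auto simp: supported_in_def)
  qed (simp add: supported_in_def)
  then show "mpol.span (mon ` A) \<subseteq> (supported_in A :: 'k mpol set)"
    by (intro mpol.span_minimal) (auto simp: supported_in_def mon_def)
  show "supported_in A \<subseteq> mpol.span (mon ` A :: 'k mpol set)"
  proof
    fix p :: "'k mpol" assume p: "p \<in> supported_in A"
    have "(\<Sum>v\<in>keys p. scale (lookup p v) (mon v)) \<in> mpol.span (mon ` A)"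
      using p by (intro mpol.span_sum mpol.span_scale mpol.span_base) (auto simp: supported_in_def)
    then show "p \<in> mpol.span (mon ` A)" by (simp add: scale_mon sum_single_lookup)
  qed
qed

definition standard_expos :: "nat \<Rightarrow> 'k::field mpol set \<Rightarrow> expo set" where
  "standard_expos n I = {w \<in> expos {1..n}. mon w \<notin> I}"

text \<open>The exponents of the monomial basis of the Stanley space \<open>uK[Z]\<close>.\<close>

definition cone :: "expo \<Rightarrow> nat set \<Rightarrow> expo set" where
  "cone u Z = (+) u ` expos Z"

lemma compl_space_eq: "compl_space n I = supported_in (standard_expos n I)"
proof -
  have "monomials n - I = mon ` standard_expos n I"
    by (auto simp: monomials_def standard_expos_def)
  then show ?thesis by (simp add: compl_space_def span_mon)
qed

lemma stanley_space_eq: "stanley_space u Z = supported_in (cone u Z)"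
proof -
  have "{mon u * mon v |v. v \<in> expos Z} = (mon ` cone u Z :: 'a mpol set)"
    by (auto simp: mon_mult cone_def)
  then show ?thesis by (simp add: stanley_space_def span_mon)
qed

text \<open>All spaces involved are spanned by monomials, so the direct sum condition becomes a
  partition into cones. The ideal enters only through its standard exponents, and what remains is
  combinatorial.\<close>

lemma stanley_decomp_iff:
  "stanley_decomp n I D \<longleftrightarrow> finite D \<and> D \<subseteq> expos {1..n} \<times> Pow {1..n} \<and>
    (\<Union>i\<in>D. cone (fst i) (snd i)) = standard_expos n I \<and>
    (\<forall>i\<in>D. \<forall>j\<in>D. i \<noteq> j \<longrightarrow> cone (fst i) (snd i) \<inter> cone (fst j) (snd j) = {})"
  unfolding stanley_decomp_def compl_space_eq stanley_space_eq case_prod_beta'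
  by (simp only: direct_sum_supported_in_iff cong: conj_cong)

section \<open>Cones and the removal of one coordinate\<close>

lemma in_expos_iff: "v \<in> expos Z \<longleftrightarrow> (\<forall>i. i \<notin> Z \<longrightarrow> lookup v i = 0)"
  by (auto simp: expos_def in_keys_iff)

lemma in_cone_iff:
  "w \<in> cone u Z \<longleftrightarrow> (\<forall>i. lookup u i \<le> lookup w i \<and> (i \<notin> Z \<longrightarrow> lookup w i = lookup u i))"
    (is "_ \<longleftrightarrow> ?R")
proof
  assume "w \<in> cone u Z"
  then show ?R by (auto simp: cone_def in_expos_iff lookup_add)
next
  assume R: ?R
  \<comment> \<open>Subtraction of exponents is truncated; the inequality in the hypothesis makes it
    exact.\<close>
  have "w = u + (w - u)" by (rule poly_mapping_eqI) (use R in \<open>simp add: lookup_add lookup_minus\<close>)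
  moreover have "w - u \<in> expos Z" using R by (simp add: in_expos_iff lookup_minus)
  ultimately show "w \<in> cone u Z" unfolding cone_def by (rule image_eqI)
qed

text \<open>The effect on exponents of substituting 1 for the variable of index
  \<open>i\<close>.\<close>

definition forget :: "nat \<Rightarrow> expo \<Rightarrow> expo" where
  "forget i v = v - single i (lookup v i)"

lemma lookup_forget: "lookup (forget i v) j = (if j = i then 0 else lookup v j)"
  by (simp add: forget_def lookup_minus lookup_single when_def)

lemma forget_add: "forget i (u + v) = forget i u + forget i v"
  by (rule poly_mapping_eqI) (simp add: lookup_forget lookup_add)

lemma forget_single: "forget i (single j k) = (if j = i then 0 else single j k)"
  by (rule poly_mapping_eqI) (simp add: lookup_forget lookup_single when_def)

lemma forget_plus_single: "forget i v + single i (lookup v i) = v"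
  by (rule poly_mapping_eqI) (simp add: lookup_forget lookup_add lookup_single when_def)

lemma forget_id: "lookup v i = 0 \<Longrightarrow> forget i v = v"
  by (simp add: forget_def)

text \<open>With \<open>n\<close> in \<open>Z\<close>, the cone restricts the \<open>n\<close>-th
  coordinate only by the lower bound \<open>lookup u n\<close>. The other coordinates are governed
  by the cone with \<open>x_n\<close> removed.\<close>

lemma add_single_in_cone_iff:
  assumes "lookup w n = 0" "n \<in> Z"
  shows "w + single n k \<in> cone u Z \<longleftrightarrow> w \<in> cone (forget n u) (Z - {n}) \<and> lookup u n \<le> k"
  using assms by (auto simp: in_cone_iff lookup_add lookup_single lookup_forget when_def)

text \<open>If \<open>n\<close> were not in \<open>Z\<close>, the \<open>n\<close>-th coordinate
  would be constantly \<open>lookup u n\<close> on the cone.\<close>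

lemma add_single_in_cone_imp_mem:
  assumes "lookup w n = 0" "w + single n k \<in> cone u Z" "lookup u n < k"
  shows "n \<in> Z"
proof (rule ccontr)
  assume "n \<notin> Z"
  then have "lookup (w + single n k) n = lookup u n" using assms(2) by (simp add: in_cone_iff)
  then show False using assms(1,3) by (simp add: lookup_add)
qed

section \<open>The polynomial ring and its monomial ideals\<close>

lemma expos_add: "u \<in> expos Z \<Longrightarrow> v \<in> expos Z \<Longrightarrow> u + v \<in> expos Z"
  by (auto simp: in_expos_iff lookup_add)

lemma carrier_polring: "carrier (polring n) = supported_in (expos {1..n})"
  by (simp add: polring_def supported_in_def)

lemma polring_simps [simp]:
  "mult (polring n) = (*)" "one (polring n) = 1" "zero (polring n) = 0" "add (polring n) = (+)"
  by (simp_all add: polring_def)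

lemma supported_in_uminus: "p \<in> supported_in A \<Longrightarrow> - p \<in> supported_in A"
  for p :: "'a \<Rightarrow>\<^sub>0 'b::ab_group_add"
  by (auto simp: supported_in_def in_keys_iff)

lemma supported_in_add: "p \<in> supported_in A \<Longrightarrow> q \<in> supported_in A \<Longrightarrow> p + q \<in> supported_in A"
  using keys_add[of p q] by (auto simp: supported_in_def)

lemma supported_in_mult:
  assumes "p \<in> supported_in A" "q \<in> supported_in B" "\<And>a b. a \<in> A \<Longrightarrow> b \<in> B \<Longrightarrow> a + b \<in> C"
  shows "p * q \<in> supported_in C"
  using keys_mult[of p q] assms by (fastforce simp: supported_in_def)

lemma cring_polring: "cring (polring n :: 'k::field mpol ring)"
proof (rule cringI)
  show "abelian_group (polring n :: 'k mpol ring)"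
  proof (rule abelian_groupI)
    fix p :: "'k mpol" assume "p \<in> carrier (polring n)"
    then show "\<exists>q\<in>carrier (polring n). q \<oplus>\<^bsub>polring n\<^esub> p = \<zero>\<^bsub>polring n\<^esub>"
      by (intro bexI[of _ "- p"]) (simp_all add: carrier_polring supported_in_uminus)
  qed (auto simp: carrier_polring supported_in_add algebra_simps, simp add: supported_in_def)
  show "Group.comm_monoid (polring n :: 'k mpol ring)"
    by (rule comm_monoidI)
      (auto simp: carrier_polring mult_ac intro: supported_in_mult expos_add,
        simp add: supported_in_def expos_def)
qed (auto simp: algebra_simps)

lemma monomial_ideal_ideal:
  assumes "monomial_ideal n I"
  shows "ideal I (polring n)"
proof -
  interpret cring "polring n :: 'a mpol ring" by (rule cring_polring)
  obtain G where "G \<subseteq> monomials n" "I = genideal (polring n) G"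
    using assms by (auto simp: monomial_ideal_def)
  moreover have "(monomials n :: 'a mpol set) \<subseteq> carrier (polring n)"
    by (auto simp: monomials_def carrier_polring supported_in_def mon_def)
  ultimately show ?thesis using genideal_ideal[of G] by auto
qed

lemma mon_add_in_ideal:
  assumes "ideal I (polring n)" "mon u \<in> I" "v \<in> expos {1..n}"
  shows "mon (v + u) \<in> I"
proof -
  have "mon v \<in> carrier (polring n)"
    using assms(3) by (simp add: carrier_polring supported_in_def mon_def)
  then have "mon v \<otimes>\<^bsub>polring n\<^esub> mon u \<in> I" using assms(1,2) by (intro ideal.I_l_closed)
  then show ?thesis by (simp add: mon_mult)
qed

text \<open>The exponents of the monomials in \<open>I\<close> are closed under adding exponents of
  the ring, so the polynomials supported in them form an ideal. It contains the generators, hence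
  all of \<open>I\<close> by minimality.\<close>

lemma monomial_ideal_keys:
  fixes I :: "'k::field mpol set"
  assumes I: "monomial_ideal n I" and p: "p \<in> I" "v \<in> keys p"
  shows "mon v \<in> I"
proof -
  interpret cring "polring n :: 'k mpol ring" by (rule cring_polring)
  have idl: "ideal I (polring n)" using I by (rule monomial_ideal_ideal)
  obtain G where G: "G \<subseteq> monomials n" "I = genideal (polring n) G"
    using I by (auto simp: monomial_ideal_def)
  define A where "A = {v \<in> expos {1..n}. (mon v :: 'k mpol) \<in> I}"
  have A_add: "u + v \<in> A" if "u \<in> expos {1..n}" "v \<in> A" for u v
    using that mon_add_in_ideal[OF idl] by (simp add: A_def expos_add)
  have "ideal (supported_in A :: 'k mpol set) (polring n)"
  proof (rule idealI)
    show "subgroup (supported_in A :: 'k mpol set) (add_monoid (polring n))"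
    proof (rule add.subgroupI)
      show sub: "supported_in A \<subseteq> carrier (polring n)"
        by (auto simp: carrier_polring supported_in_def A_def)
      have "0 \<in> supported_in A" by (simp add: supported_in_def)
      then show "supported_in A \<noteq> {}" by blast
      fix p :: "'k mpol" assume p: "p \<in> supported_in A"
      \<comment> \<open>The inverse of the ring structure is an abstract group inverse and must be
        identified with negation of polynomials.\<close>
      have "\<ominus>\<^bsub>polring n\<^esub> p = - p"
        using p sub by (intro minus_equality) (auto simp: supported_in_uminus)
      then show "\<ominus>\<^bsub>polring n\<^esub> p \<in> supported_in A" using p by (simp add: supported_in_uminus)
    qed (simp add: supported_in_add)
    fix p q :: "'k mpol" assume p: "p \<in> supported_in A" and q: "q \<in> carrier (polring n)"
    have "q * p \<in> supported_in A"
      using q[unfolded carrier_polring] p A_add by (rule supported_in_mult)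
    then show "q \<otimes>\<^bsub>polring n\<^esub> p \<in> supported_in A" "p \<otimes>\<^bsub>polring n\<^esub> q \<in> supported_in A"
      by (simp_all add: mult.commute)
  qed (rule ring_axioms)
  moreover have "G \<subseteq> supported_in A"
  proof
    fix g assume g: "g \<in> G"
    then obtain u where "g = mon u" "u \<in> expos {1..n}" using G(1) by (auto simp: monomials_def)
    moreover have "g \<in> I" using g unfolding G(2) genideal_def by auto
    ultimately show "g \<in> supported_in A" by (simp add: supported_in_def A_def mon_def)
  qed
  ultimately have "I \<subseteq> supported_in A" unfolding G(2) by (rule genideal_minimal)
  then show ?thesis using p by (auto simp: supported_in_def A_def)
qed

section \<open>The substitution homomorphism on monomials and monomial ideals\<close>

context
  fixes n :: nat and \<phi> :: "'k::field mpol \<Rightarrow> 'k mpol"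
  assumes alg_hom: "alg_hom n (n - 1) \<phi>"
    and \<phi>_Var: "\<And>i. i \<in> {1..n - 1} \<Longrightarrow> \<phi> (Var i) = Var i"
    and \<phi>_Var_n: "\<phi> (Var n) = 1"
begin

lemma \<phi>_add: "p \<in> supported_in (expos {1..n}) \<Longrightarrow> q \<in> supported_in (expos {1..n})
    \<Longrightarrow> \<phi> (p + q) = \<phi> p + \<phi> q"
  and \<phi>_mult: "p \<in> supported_in (expos {1..n}) \<Longrightarrow> q \<in> supported_in (expos {1..n})
    \<Longrightarrow> \<phi> (p * q) = \<phi> p * \<phi> q"
  and \<phi>_Const: "\<phi> (Const c) = Const c"
  using alg_hom by (auto simp: alg_hom_def ring_hom_def carrier_polring)

lemma mon_supported: "v \<in> expos {1..n} \<Longrightarrow> mon v \<in> supported_in (expos {1..n})"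
  by (simp add: supported_in_def mon_def)

text \<open>Induction on the power. Using \<open>forget n\<close> treats \<open>i = n\<close>, where
  both sides are 1, together with the variables that are kept.\<close>

lemma \<phi>_mon_single:
  assumes "i \<in> {1..n}"
  shows "\<phi> (mon (single i k)) = mon (forget n (single i k))"
proof (induction k)
  case 0
  then show ?case using \<phi>_Const[of 1] by (simp add: mon_def Const_def forget_def)
next
  case (Suc k)
  have sup: "mon (single i l) \<in> supported_in (expos {1..n})" for l
    using assms by (intro mon_supported) (auto simp: expos_def)
  have \<phi>_i: "\<phi> (mon (single i 1)) = mon (forget n (single i 1))"
  proof (cases "i = n")
    case True
    then show ?thesis using \<phi>_Var_n by (simp add: Var_def forget_single mon_0)
  next
    case False
    then have "i \<in> {1..n - 1}" using assms by auto
    then show ?thesis using \<phi>_Var[of i] False by (simp add: Var_def forget_single)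
  qed
  have "single i (Suc k) = single i 1 + single i k"
    by (simp add: single_add[symmetric])
  then have "\<phi> (mon (single i (Suc k))) = \<phi> (mon (single i 1) * mon (single i k))"
    by (simp add: mon_mult)
  also have "\<dots> = mon (forget n (single i 1)) * mon (forget n (single i k))"
    using \<phi>_mult[OF sup sup, of 1 k] \<phi>_i Suc.IH by simp
  also have "\<dots> = mon (forget n (single i (Suc k)))"
    by (simp add: mon_mult forget_add[symmetric] single_add[symmetric])
  finally show ?case .
qed

text \<open>The monomial is built up by one power of a new variable per induction step.\<close>

lemma \<phi>_mon: "v \<in> expos {1..n} \<Longrightarrow> \<phi> (mon v) = mon (forget n v)"
proof (induction v rule: update_induct)
  case const
  then show ?case using \<phi>_Const[of 1] by (simp add: mon_def Const_def forget_def)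
next
  case (update v i k)
  \<comment> \<open>The index \<open>i\<close> does not occur in \<open>v\<close>, so updating there
    amounts to adding.\<close>
  have eq: "Poly_Mapping.update i k v = single i k + v"
    using update.hyps
    by (intro poly_mapping_eqI) (auto simp: lookup_update lookup_add lookup_single when_def in_keys_iff)
  have i: "i \<in> {1..n}" and v: "v \<in> expos {1..n}"
    using update.prems update.hyps unfolding expos_def by (auto simp: keys_update)
  have "single i k \<in> expos {1..n}" using i by (auto simp: expos_def)
  then have "\<phi> (mon (single i k) * mon v) = mon (forget n (single i k)) * mon (forget n v)"
    using \<phi>_mult[OF mon_supported mon_supported] v i update.IH \<phi>_mon_single by simp
  then show ?case by (simp add: eq mon_mult forget_add)
qed

lemma \<phi>_sum_single:
  "finite A \<Longrightarrow> A \<subseteq> expos {1..n} \<Longrightarrow>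
    \<phi> (\<Sum>v\<in>A. single v (c v)) = (\<Sum>v\<in>A. single (forget n v) (c v))"
proof (induction A rule: finite_induct)
  case empty
  then show ?case using \<phi>_Const[of 0] by (simp add: Const_def)
next
  case (insert v A)
  have C: "(Const (c v) :: 'k mpol) \<in> supported_in (expos {1..n})"
    by (auto simp: Const_def supported_in_def expos_def)
  have "\<phi> (single v (c v)) = \<phi> (Const (c v) * mon v)"
    by (simp add: Const_def mon_def mult_single)
  also have "\<dots> = single (forget n v) (c v)"
    using \<phi>_mult[OF C mon_supported] insert.prems \<phi>_mon[of v]
    by (simp add: \<phi>_Const) (simp add: Const_def mon_def mult_single)
  finally have "\<phi> (single v (c v)) = single (forget n v) (c v)" .
  moreover have "(single v (c v)) \<in> supported_in (expos {1..n})"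
    using insert.prems by (auto simp: supported_in_def)
  moreover have "(\<Sum>v\<in>A. single v (c v)) \<in> supported_in (expos {1..n})"
    using insert.prems keys_sum[of "\<lambda>v. single v (c v)" A]
    by (fastforce simp: supported_in_def split: if_splits)
  ultimately show ?case using insert by (simp add: \<phi>_add)
qed

text \<open>Only an inclusion: exponents differing just in the \<open>n\<close>-th coordinate are
  merged, and their coefficients may cancel.\<close>

lemma keys_\<phi>:
  assumes "p \<in> supported_in (expos {1..n})"
  shows "keys (\<phi> p) \<subseteq> forget n ` keys p"
proof -
  have "\<phi> p = (\<Sum>v\<in>keys p. single (forget n v) (lookup p v))"
    using \<phi>_sum_single[of "keys p" "lookup p"] assms
    by (simp add: sum_single_lookup supported_in_def)
  then show ?thesis
    using keys_sum[of "\<lambda>v. single (forget n v) (lookup p v)" "keys p"] by fastforce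
qed

text \<open>A preimage \<open>p\<close> of \<open>mon w\<close> has a term whose exponent becomes
  \<open>w\<close> when \<open>x_n\<close> is removed, and a monomial ideal contains the monomials
  of its members. Conversely, \<open>\<phi>\<close> sends \<open>w\<close> times any power of
  \<open>x_n\<close> to \<open>w\<close>.\<close>

lemma mon_in_\<phi>_image_iff:
  assumes "monomial_ideal n I" "w \<in> expos {1..n - 1}" "n \<ge> 1"
  shows "mon w \<in> \<phi> ` I \<longleftrightarrow> (\<exists>k. mon (w + single n k) \<in> I)"
proof
  have sub: "I \<subseteq> supported_in (expos {1..n})"
    unfolding carrier_polring[symmetric]
    using ideal.Icarr[OF monomial_ideal_ideal[OF assms(1)]] by (rule subsetI)
  have wn: "lookup w n = 0" using assms(2,3) by (simp add: in_expos_iff)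
  {
    assume "mon w \<in> \<phi> ` I"
    then obtain p where p: "p \<in> I" "mon w = \<phi> p" by blast
    have "w \<in> keys (\<phi> p)" by (simp add: p(2)[symmetric] mon_def)
    then obtain v where v: "v \<in> keys p" "w = forget n v" using keys_\<phi> p(1) sub by blast
    then have "mon (w + single n (lookup v n)) \<in> I"
      using monomial_ideal_keys[OF assms(1) p(1)] by (simp add: forget_plus_single)
    then show "\<exists>k. mon (w + single n k) \<in> I" ..
  }
  {
    assume "\<exists>k. mon (w + single n k) \<in> I"
    then obtain k where k: "mon (w + single n k) \<in> I" ..
    then have "w + single n k \<in> expos {1..n}" using sub by (auto simp: supported_in_def mon_def)
    then have "\<phi> (mon (w + single n k)) = mon w"
      using wn by (simp add: \<phi>_mon forget_add forget_single forget_id)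
    then show "mon w \<in> \<phi> ` I" using k by (metis imageI)
  }
qed

section \<open>The induced Stanley decomposition\<close>

lemma stanley_decomp_\<phi>_image:
  assumes I: "monomial_ideal n I" and n: "n \<ge> 1" and D: "stanley_decomp n I D"
  shows "stanley_decomp (n - 1) (\<phi> ` I) ((\<lambda>(u, Z). (forget n u, Z - {n})) ` {(u, Z) \<in> D. n \<in> Z})"
    (is "stanley_decomp _ _ ?D'")
proof -
  have idl: "ideal I (polring n)" using I by (rule monomial_ideal_ideal)
  have fin: "finite D" and D_sub: "D \<subseteq> expos {1..n} \<times> Pow {1..n}"
    and union: "(\<Union>i\<in>D. cone (fst i) (snd i)) = standard_expos n I"
    and disj: "\<forall>i\<in>D. \<forall>j\<in>D. i \<noteq> j \<longrightarrow> cone (fst i) (snd i) \<inter> cone (fst j) (snd j) = {}"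
    using D unfolding stanley_decomp_iff by simp_all
  have cover: "w \<in> standard_expos n I \<longleftrightarrow> (\<exists>(u, Z)\<in>D. w \<in> cone u Z)" for w
    unfolding union[symmetric] by (simp add: split_beta)
  \<comment> \<open>Inserting 0 keeps the maximum defined for empty \<open>D\<close>;
    \<open>Suc\<close> gives the strict bound that forces \<open>n\<close> into
    \<open>Z\<close>.\<close>
  define N where "N = Suc (Max (insert 0 ((\<lambda>(u, Z). lookup u n) ` D)))"
  have N: "lookup u n < N" if "(u, Z) \<in> D" for u Z
  proof -
    have "lookup u n \<in> insert 0 ((\<lambda>(u, Z). lookup u n) ` D)" using that by force
    then show ?thesis unfolding N_def using fin by (simp add: less_Suc_eq_le)
  qed
  have expos_le: "w \<in> expos {1..n - 1} \<Longrightarrow> w + single n k \<in> expos {1..n}" for w k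
    using n by (auto simp: in_expos_iff lookup_add lookup_single when_def)
  have cone_iff: "w + single n k \<in> cone u Z \<longleftrightarrow> w \<in> cone (forget n u) (Z - {n})"
    if "(u, Z) \<in> D" "n \<in> Z" "lookup w n = 0" "k \<ge> N" for u Z w k
    using add_single_in_cone_iff[of w n Z k u] that N[of u Z] by simp
  have cone_expos: "w \<in> cone (forget n u) (Z - {n}) \<Longrightarrow> w \<in> expos {1..n - 1}" if "(u, Z) \<in> D" for u Z w
  proof -
    assume w: "w \<in> cone (forget n u) (Z - {n})"
    have uZ: "u \<in> expos {1..n}" "Z \<subseteq> {1..n}" using that D_sub by auto
    have "lookup w i = 0" if "i \<notin> {1..n - 1}" for i
    proof -
      have i: "i = n \<or> i \<notin> {1..n}" using that n by auto
      then have "i \<notin> Z - {n}" using uZ(2) by blast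
      then have "lookup w i = lookup (forget n u) i" using w by (simp add: in_cone_iff)
      also have "\<dots> = 0" using i uZ(1) unfolding lookup_forget in_expos_iff by metis
      finally show ?thesis .
    qed
    then show ?thesis by (simp add: in_expos_iff)
  qed
  have cover': "(\<exists>(u, Z)\<in>?D'. w \<in> cone u Z) \<longleftrightarrow> w \<in> standard_expos (n - 1) (\<phi> ` I)" (is "?L \<longleftrightarrow> ?R") for w
  proof
    assume ?L
    then obtain u Z where uZ: "(u, Z) \<in> D" "n \<in> Z" and w: "w \<in> cone (forget n u) (Z - {n})" by auto
    have we: "w \<in> expos {1..n - 1}" using cone_expos uZ(1) w by blast
    then have wn: "lookup w n = 0" using n by (simp add: in_expos_iff)
    have "mon (w + single n k) \<notin> I" for k
    proof
      assume "mon (w + single n k) \<in> I"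
      \<comment> \<open>The power \<open>k\<close> may be too small for \<open>cone_iff\<close>.
        Multiplying by a further \<open>N\<close>-th power of \<open>x_n\<close> stays in
        \<open>I\<close> and reaches the range where the exponent lies in the cone of
        \<open>u\<close> and \<open>Z\<close>, hence is standard.\<close>
      moreover have "single n N \<in> expos {1..n}" using n by (auto simp: expos_def)
      ultimately have "mon (single n N + (w + single n k)) \<in> I" by (rule mon_add_in_ideal[OF idl])
      moreover have "single n N + (w + single n k) = w + single n (N + k)"
        by (simp add: single_add ac_simps)
      moreover have "w + single n (N + k) \<in> cone u Z" using cone_iff uZ wn w by simp
      then have "w + single n (N + k) \<in> standard_expos n I" using cover uZ(1) by blast
      ultimately show False by (simp add: standard_expos_def)
    qed
    then show ?R using we mon_in_\<phi>_image_iff[OF I we n] by (simp add: standard_expos_def)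
  next
    assume ?R
    then have we: "w \<in> expos {1..n - 1}" and "mon w \<notin> \<phi> ` I" by (auto simp: standard_expos_def)
    then have "w + single n N \<in> standard_expos n I"
      using mon_in_\<phi>_image_iff[OF I we n] expos_le by (simp add: standard_expos_def)
    then obtain u Z where uZ: "(u, Z) \<in> D" "w + single n N \<in> cone u Z" using cover by blast
    have wn: "lookup w n = 0" using we n by (simp add: in_expos_iff)
    have nZ: "n \<in> Z" using add_single_in_cone_imp_mem[OF wn uZ(2)] N uZ(1) by blast
    have "(forget n u, Z - {n}) \<in> ?D'" using uZ(1) nZ by force
    then show ?L using cone_iff[OF uZ(1) nZ wn, of N] uZ(2) by blast
  qed
  \<comment> \<open>A common exponent of two projected cones, raised to height \<open>N\<close>,
    lies in both original cones. Disjointness in \<open>D\<close> then makes the original pairs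
    equal, so distinct pairs of \<open>D\<close> containing \<open>n\<close> are not merged
    either.\<close>
  have inj: "i = j"
    if "i \<in> ?D'" "j \<in> ?D'" "w \<in> cone (fst i) (snd i)" "w \<in> cone (fst j) (snd j)" for i j w
  proof -
    obtain u Z where u: "(u, Z) \<in> D" "n \<in> Z" "i = (forget n u, Z - {n})" using \<open>i \<in> ?D'\<close> by auto
    obtain v Y where v: "(v, Y) \<in> D" "n \<in> Y" "j = (forget n v, Y - {n})" using \<open>j \<in> ?D'\<close> by auto
    have "lookup w n = 0" using cone_expos[OF u(1)] that(3) u(3) n by (simp add: in_expos_iff)
    then have "w + single n N \<in> cone u Z" "w + single n N \<in> cone v Y"
      using cone_iff u v that(3,4) by simp_all
    then have "(u, Z) = (v, Y)" using disj[rule_format, OF u(1) v(1)] by auto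
    then show "i = j" using u v by simp
  qed
  have "finite ?D'"
    using fin by (intro finite_imageI) (auto intro: finite_subset)
  moreover have "?D' \<subseteq> expos {1..n - 1} \<times> Pow {1..n - 1}"
  proof
    fix i assume "i \<in> ?D'"
    then obtain u Z where uZ: "(u, Z) \<in> D" "i = (forget n u, Z - {n})" by auto
    \<comment> \<open>The apex belongs to its own cone, so \<open>cone_expos\<close> applies to
      it.\<close>
    have "forget n u \<in> expos {1..n - 1}" using cone_expos[OF uZ(1)] by (simp add: in_cone_iff)
    moreover have "Z - {n} \<subseteq> {1..n - 1}" using uZ(1) D_sub by force
    ultimately show "i \<in> expos {1..n - 1} \<times> Pow {1..n - 1}" by (simp add: uZ(2))
  qed
  moreover have "(\<Union>i\<in>?D'. cone (fst i) (snd i)) = standard_expos (n - 1) (\<phi> ` I)"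
    by (rule Set.set_eqI) (simp only: UN_iff cover'[symmetric] case_prod_beta')
  moreover have "\<forall>i\<in>?D'. \<forall>j\<in>?D'. i \<noteq> j \<longrightarrow> cone (fst i) (snd i) \<inter> cone (fst j) (snd j) = {}"
  proof (intro ballI impI equals0I)
    fix i j w assume ij: "i \<in> ?D'" "j \<in> ?D'" "i \<noteq> j"
      and w: "w \<in> cone (fst i) (snd i) \<inter> cone (fst j) (snd j)"
    from inj[OF ij(1,2) IntD1[OF w] IntD2[OF w]] ij(3) show False by contradiction
  qed
  ultimately show ?thesis
    unfolding stanley_decomp_iff by (intro conjI)
qed

end

section \<open>Comparison of Stanley depths\<close>

theorem corollary3p2:
  fixes n :: nat
    and \<phi> :: "'k::field mpol \<Rightarrow> 'k mpol"
    and I :: "'k mpol set"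
  assumes "n \<ge> 1"
    and "alg_hom n (n - 1) \<phi>"
    and "\<And>i. i \<in> {1..n - 1} \<Longrightarrow> \<phi> (Var i) = Var i"
    and "\<phi> (Var n) = 1"
    and "monomial_ideal n I"
  shows "sdepth n I \<le> sdepth (n - 1) (\<phi> ` I) + 1"
  unfolding sdepth_def[of n]
proof (rule SUP_least)
  fix D assume "D \<in> {D. stanley_decomp n I D}"
  then have D: "stanley_decomp n I D" by simp
  let ?D' = "(\<lambda>(u, Z). (forget n u, Z - {n})) ` {(u, Z) \<in> D. n \<in> Z}"
  have D': "stanley_decomp (n - 1) (\<phi> ` I) ?D'"
    using assms D by (intro stanley_decomp_\<phi>_image)
  \<comment> \<open>Each surviving \<open>Z\<close> loses exactly one element. If none survives, the
    infimum on the right is infinite and there is nothing to check.\<close>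
  have "sdepth_decomp D - 1 \<le> sdepth_decomp ?D'"
    unfolding sdepth_decomp_def[of ?D']
  proof (rule INF_greatest)
    fix i assume "i \<in> ?D'"
    then obtain u Z where uZ: "(u, Z) \<in> D" "n \<in> Z" "i = (forget n u, Z - {n})" by auto
    have "sdepth_decomp D \<le> enat (card Z)"
      unfolding sdepth_decomp_def using INF_lower[OF uZ(1), of "\<lambda>(u, Z). enat (card Z)"] by simp
    moreover have "card (Z - {n}) = card Z - 1"
      using uZ(2) by (rule card_Diff_singleton)
    ultimately show "sdepth_decomp D - 1 \<le> (case i of (u, Z) \<Rightarrow> enat (card Z))"
      using uZ(3) by (cases "sdepth_decomp D") (auto simp: one_enat_def)
  qed
  also have "\<dots> \<le> sdepth (n - 1) (\<phi> ` I)"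
    unfolding sdepth_def using D' by (intro SUP_upper) simp
  \<comment> \<open>Moving the 1 across is safe for truncated subtraction, and an infinite left side
    stays infinite after subtracting 1.\<close>
  finally show "sdepth_decomp D \<le> sdepth (n - 1) (\<phi> ` I) + 1"
    by (cases "sdepth_decomp D"; cases "sdepth (n - 1) (\<phi> ` I)") (auto simp: one_enat_def)
qed

end
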